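(* Let $D=\{(x,y)\in{}^2({}^\omega({}^\omega2)):x(0)\neq y(0)\}$. Then $D$ is dense open in ${}^2({}^\omega({}^\omega2))$, and for every $\Sigma^1_1$ set $B\subseteq{}^\omega({}^\omega2)$ with $E_3\upharpoonright B\equiv_{\Delta^1_1}E_3$, we have $[B]^2_{E_3}\not\subseteq D$. Consequently $E_3$ does not have the $2$-Mycielski property.
   Context: ${}^\omega({}^\omega2)$ carries the product topology. $E_0$ on ${}^\omega2$: $x\,E_0\,y$ iff $(\exists n)(\forall k>n)(x(k)=y(k))$. $E_3$ is the equivalence relation on ${}^\omega({}^\omega2)$ given by $x\,E_3\,y$ iff $x(n)\,E_0\,y(n)$ for all $n$. For an equivalence relation $E$ on a set $X$, $[X]^n_E=\{(x_0,\dots,x_{n-1})\in{}^nX:(\forall i\neq j)\,\neg(x_i\,E\,x_j)\}$. $E\le_{\Delta^1_1}F$ means there is a $\Delta^1_1$ function $\Phi$ with $a\,E\,b\iff\Phi(a)\,F\,\Phi(b)$; $E\equiv_{\Delta^1_1}F$ means both directions. An equivalence relation $E$ on a Polish space $X$ has the $n$-Mycielski property iff for every comeager $C\subseteq{}^nX$ there is a $\Delta^1_1$ set $A\subseteq X$ with $E\equiv_{\Delta^1_1}E\upharpoonright A$ and $[A]^n_E\subseteq C$. *)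

theory Defs
  imports "HOL-Analysis.Analysis"
begin

section \<open>Boldface projective classes\<close>

definition baire_space :: "(nat \<Rightarrow> nat) topology" where
  "baire_space = product_topology (\<lambda>_. discrete_topology UNIV) UNIV"

text \<open>
  All pointclasses are boldface. They are meant for Polish spaces \<open>X\<close> and for subspaces
  \<open>subtopology X B\<close> of these with \<open>B\<close> in \<open>\<Sigma>\<^sup>1\<^sub>1\<close>; for such a subspace the sets below are exactly the
  relative ones \<open>B \<inter> S\<close> with \<open>S\<close> of the same class in \<open>X\<close>.
\<close>

definition Sigma11_in :: "'a topology \<Rightarrow> 'a set \<Rightarrow> bool" where
  "Sigma11_in X S \<longleftrightarrow> (\<exists>F. closedin (prod_topology X baire_space) F \<and> S = fst ` F)"

definition Delta11_in :: "'a topology \<Rightarrow> 'a set \<Rightarrow> bool" where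
  "Delta11_in X S \<longleftrightarrow> S \<subseteq> topspace X \<and> Sigma11_in X S \<and> Sigma11_in X (topspace X - S)"

definition Delta11_map :: "'a topology \<Rightarrow> 'b topology \<Rightarrow> ('a \<Rightarrow> 'b) \<Rightarrow> bool" where
  "Delta11_map X Y f \<longleftrightarrow> f \<in> topspace X \<rightarrow> topspace Y \<and>
     (\<forall>U. openin Y U \<longrightarrow> Delta11_in X {x \<in> topspace X. f x \<in> U})"

section \<open>Equivalence relations and reductions\<close>

text \<open>
  An equivalence relation on the space \<open>X\<close> is an \<open>E\<close> with \<open>equiv (topspace X) E\<close>. The restriction
  of \<open>E\<close> to \<open>A\<close> is \<open>Restr E A\<close>, living on the space \<open>subtopology X A\<close>.
\<close>

definition Delta11_reducible ::
    "'a topology \<Rightarrow> 'a rel \<Rightarrow> 'b topology \<Rightarrow> 'b rel \<Rightarrow> bool" where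
  "Delta11_reducible X E Y F \<longleftrightarrow>
     (\<exists>\<Phi>. Delta11_map X Y \<Phi> \<and>
        (\<forall>a \<in> topspace X. \<forall>b \<in> topspace X. (a, b) \<in> E \<longleftrightarrow> (\<Phi> a, \<Phi> b) \<in> F))"

definition Delta11_bireducible ::
    "'a topology \<Rightarrow> 'a rel \<Rightarrow> 'b topology \<Rightarrow> 'b rel \<Rightarrow> bool" where
  "Delta11_bireducible X E Y F \<longleftrightarrow> Delta11_reducible X E Y F \<and> Delta11_reducible Y F X E"

section \<open>The Mycielski property\<close>

text \<open>The power \<open>\<^sup>nX\<close>: its points are the functions that are \<open>undefined\<close> outside \<open>{..<n}\<close>.\<close>

definition power_topology :: "nat \<Rightarrow> 'a topology \<Rightarrow> (nat \<Rightarrow> 'a) topology" where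
  "power_topology n X = product_topology (\<lambda>_. X) {..<n}"

definition inequivalent_tuples :: "'a rel \<Rightarrow> nat \<Rightarrow> 'a set \<Rightarrow> (nat \<Rightarrow> 'a) set" where
  "inequivalent_tuples E n A =
     {x \<in> {..<n} \<rightarrow>\<^sub>E A. \<forall>i<n. \<forall>j<n. i \<noteq> j \<longrightarrow> (x i, x j) \<notin> E}"

definition nowhere_dense_in :: "'a topology \<Rightarrow> 'a set \<Rightarrow> bool" where
  "nowhere_dense_in X S \<longleftrightarrow> S \<subseteq> topspace X \<and> X interior_of (X closure_of S) = {}"

definition meager_in :: "'a topology \<Rightarrow> 'a set \<Rightarrow> bool" where
  "meager_in X S \<longleftrightarrow> (\<exists>N :: nat \<Rightarrow> 'a set. (\<forall>k. nowhere_dense_in X (N k)) \<and> S = (\<Union>k. N k))"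

definition comeager_in :: "'a topology \<Rightarrow> 'a set \<Rightarrow> bool" where
  "comeager_in X C \<longleftrightarrow> C \<subseteq> topspace X \<and> meager_in X (topspace X - C)"

text \<open>
  That \<open>X\<close> is Polish and \<open>E\<close> is an equivalence relation on it is presupposed rather than made part of
  the property, so that failure of the property can only be due to some comeager set \<open>C\<close>.
\<close>

definition mycielski_property :: "nat \<Rightarrow> 'a topology \<Rightarrow> 'a rel \<Rightarrow> bool" where
  "mycielski_property n X E \<longleftrightarrow>
     (\<forall>C. comeager_in (power_topology n X) C \<longrightarrow>
        (\<exists>A. Delta11_in X A \<and> Delta11_bireducible X E (subtopology X A) (Restr E A) \<and>
             inequivalent_tuples E n A \<subseteq> C))"

section \<open>The equivalence relation \<open>E\<^sub>3\<close>\<close>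

definition cantor_space :: "(nat \<Rightarrow> bool) topology" where
  "cantor_space = product_topology (\<lambda>_. discrete_topology UNIV) UNIV"

definition cantor_seq_space :: "(nat \<Rightarrow> nat \<Rightarrow> bool) topology" where
  "cantor_seq_space = product_topology (\<lambda>_. cantor_space) UNIV"

definition E0 :: "(nat \<Rightarrow> bool) rel" where
  "E0 = {(x, y). \<exists>n. \<forall>k>n. x k = y k}"

definition E3 :: "(nat \<Rightarrow> nat \<Rightarrow> bool) rel" where
  "E3 = {(x, y). \<forall>n. (x n, y n) \<in> E0}"

definition D :: "(nat \<Rightarrow> nat \<Rightarrow> nat \<Rightarrow> bool) set" where
  "D = {p \<in> topspace (power_topology 2 cantor_seq_space). p 0 0 \<noteq> p 1 0}"

lemma topspace_cantor_seq_space [simp]: "topspace cantor_seq_space = UNIV"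
  by (simp add: cantor_seq_space_def cantor_space_def)

lemma equiv_E0: "equiv UNIV E0"
proof (rule equivI)
  show "E0 \<subseteq> UNIV \<times> UNIV" by simp
  show "refl_on UNIV E0" by (simp add: refl_on_def E0_def)
  show "sym E0" by (rule symI) (simp add: E0_def eq_commute)
  show "trans E0"
  proof (rule transI)
    fix x y z assume "(x, y) \<in> E0" "(y, z) \<in> E0"
    then obtain m n where "\<forall>k>m. x k = y k" "\<forall>k>n. y k = z k"
      by (auto simp: E0_def)
    then have "\<forall>k>max m n. x k = z k" by simp
    then show "(x, z) \<in> E0" unfolding E0_def by blast
  qed
qed

lemma equiv_E3: "equiv (topspace cantor_seq_space) E3"
proof (rule equivI)
  show "E3 \<subseteq> topspace cantor_seq_space \<times> topspace cantor_seq_space" by simp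
  show "refl_on (topspace cantor_seq_space) E3"
    by (simp add: refl_on_def E3_def E0_def)
  show "sym E3"
    using equiv_E0 by (intro symI) (auto simp: E3_def equiv_def dest: symD)
  show "trans E3"
  proof (rule transI)
    fix x y z assume "(x, y) \<in> E3" "(y, z) \<in> E3"
    moreover have "trans E0" using equiv_E0 by (simp add: equiv_def)
    ultimately show "(x, z) \<in> E3" unfolding E3_def by (blast dest: transD)
  qed
qed

end

theory Submission
  imports Defs
begin

text \<open>
  If \<open>\<Phi>\<close> reduces \<open>E\<^sub>3\<close> to \<open>Restr E\<^sub>3 B\<close> where \<open>[B]\<^sup>2 \<subseteq> D\<close>, then \<open>f x = \<Phi> x 0\<close> maps \<open>E\<^sub>3\<close>-equivalent
  points to \<open>E\<^sub>0\<close>-equivalent ones, and \<open>f x = f y\<close> implies \<open>(x, y) \<in> E\<^sub>3\<close>. Since \<open>\<Sigma>\<^sup>1\<^sub>1\<close> sets have the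
  Baire property, \<open>f\<close> is continuous on a comeager set \<open>C\<close>, which can be taken invariant under
  countably many flips. A fusion argument gives a basic open set and an \<open>n\<close> such that, inside \<open>C\<close>
  and this open set, \<open>E\<^sub>3\<close>-equivalent points with the same first \<open>n\<close> rows have images agreeing from
  \<open>n\<close> on; shrinking the open set, the images are equal. Now flip a tail of row \<open>n\<close> of a point \<open>x\<close>.
  The result \<open>y\<close> is a limit of points of \<open>C\<close> that differ from \<open>x\<close> in finitely many bits of row \<open>n\<close>,
  so \<open>f y = f x\<close> although \<open>y\<close> is not \<open>E\<^sub>3\<close>-equivalent to \<open>x\<close>.
\<close>

section \<open>Meager sets and the Baire property\<close>

text \<open>Closures of nowhere dense sets give the closed cover. Conversely, cutting the closed
  sets down to \<open>S\<close> makes \<open>S\<close> an exact union of nowhere dense sets. The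
  closed form is the one used with Baire category.\<close>

lemma meager_in_iff:
  "meager_in X S \<longleftrightarrow> S \<subseteq> topspace X \<and>
     (\<exists>K :: nat \<Rightarrow> 'a set. (\<forall>k. closedin X (K k) \<and> X interior_of (K k) = {}) \<and> S \<subseteq> (\<Union>k. K k))"
    (is "_ \<longleftrightarrow> ?R")
proof
  assume "meager_in X S"
  then obtain N :: "nat \<Rightarrow> 'a set" where N: "\<And>k. nowhere_dense_in X (N k)" "S = (\<Union>k. N k)"
    unfolding meager_in_def by blast
  have "S \<subseteq> (\<Union>k. X closure_of N k)"
    using N closure_of_subset unfolding nowhere_dense_in_def by fastforce
  with N show ?R
    unfolding nowhere_dense_in_def by (intro conjI exI[of _ "\<lambda>k. X closure_of N k"]) auto
next
  assume ?R
  then obtain K :: "nat \<Rightarrow> 'a set" where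
    K: "S \<subseteq> topspace X" "\<And>k. closedin X (K k)" "\<And>k. X interior_of (K k) = {}" "S \<subseteq> (\<Union>k. K k)"
    by blast
  have "nowhere_dense_in X (K k \<inter> S)" for k
  proof -
    have "X closure_of (K k \<inter> S) \<subseteq> K k"
      using K(2)[of k] by (simp add: closure_of_minimal)
    then show ?thesis
      using K interior_of_mono[of "X closure_of (K k \<inter> S)" "K k" X]
      unfolding nowhere_dense_in_def by auto
  qed
  moreover have "S = (\<Union>k. K k \<inter> S)" using K(4) by blast
  ultimately show "meager_in X S"
    unfolding meager_in_def by (intro exI[of _ "\<lambda>k. K k \<inter> S"]) blast
qed

lemma meager_in_subset: "meager_in X S \<Longrightarrow> T \<subseteq> S \<Longrightarrow> meager_in X T"
  unfolding meager_in_iff by (meson order_trans)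

lemma meager_in_closedin:
  "closedin X K \<Longrightarrow> X interior_of K = {} \<Longrightarrow> meager_in X K"
  unfolding meager_in_iff by (auto dest: closedin_subset intro!: exI[of _ "\<lambda>_. K"])

lemma meager_in_UN:
  fixes X :: "'a topology" and A :: "'b \<Rightarrow> 'a set"
  assumes "countable I" "\<And>i. i \<in> I \<Longrightarrow> meager_in X (A i)"
  shows "meager_in X (\<Union>i\<in>I. A i)"
proof (cases "I = {}")
  case True
  then show ?thesis using meager_in_closedin[of X "{}"] by simp
next
  case False
  have "\<forall>i\<in>I. \<exists>K :: nat \<Rightarrow> 'a set.
      (\<forall>k. closedin X (K k) \<and> X interior_of (K k) = {}) \<and> A i \<subseteq> (\<Union>k. K k)"
    using assms(2) unfolding meager_in_iff by blast
  then obtain K :: "'b \<Rightarrow> nat \<Rightarrow> 'a set" where K: "\<And>i k. i \<in> I \<Longrightarrow> closedin X (K i k)"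
    "\<And>i k. i \<in> I \<Longrightarrow> X interior_of (K i k) = {}" "\<And>i. i \<in> I \<Longrightarrow> A i \<subseteq> (\<Union>k. K i k)"
    by metis
  define L where "L m = (case prod_decode m of (i, k) \<Rightarrow> K (from_nat_into I i) k)" for m
  have "(\<Union>i\<in>I. A i) \<subseteq> (\<Union>m. L m)"
  proof
    fix x assume "x \<in> (\<Union>i\<in>I. A i)"
    then obtain i k where ik: "i \<in> I" "x \<in> K i k" using K(3) by blast
    obtain j where "from_nat_into I j = i" using ik(1) assms(1) from_nat_into_surj by metis
    then have "x \<in> L (prod_encode (j, k))" using ik by (simp add: L_def)
    then show "x \<in> (\<Union>m. L m)" by blast
  qed
  moreover have "closedin X (L m) \<and> X interior_of (L m) = {}" for m
    using K from_nat_into[OF False] by (simp add: L_def split: prod.split)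
  moreover have "(\<Union>i\<in>I. A i) \<subseteq> topspace X" using assms(2) unfolding meager_in_iff by blast
  ultimately show ?thesis unfolding meager_in_iff by blast
qed

lemma meager_in_Un: "meager_in X S \<Longrightarrow> meager_in X T \<Longrightarrow> meager_in X (S \<union> T)"
  using meager_in_UN[of "{True, False}" X "\<lambda>b. if b then S else T"]
  by (simp add: Un_commute split: if_splits)

lemma interior_of_closed_minus_interior:
  assumes "closedin X K"
  shows "X interior_of (K - X interior_of K) = {}"
proof -
  have "X interior_of (K - X interior_of K) \<subseteq> X interior_of K"
    by (simp add: interior_of_mono)
  moreover have "X interior_of (K - X interior_of K) \<subseteq> K - X interior_of K"
    by (rule interior_of_subset)
  ultimately show ?thesis by blast
qed

lemma meager_in_closed_minus_interior:
  "closedin X K \<Longrightarrow> meager_in X (K - X interior_of K)"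
  by (intro meager_in_closedin interior_of_closed_minus_interior closedin_diff) auto

section \<open>Points where a set is locally nonmeager\<close>

definition heavy_part :: "'a topology \<Rightarrow> 'a set \<Rightarrow> 'a set" where
  "heavy_part X A = {x \<in> topspace X. \<forall>U. openin X U \<and> x \<in> U \<longrightarrow> \<not> meager_in X (U \<inter> A)}"

lemma closedin_heavy_part: "closedin X (heavy_part X A)"
proof -
  have "topspace X - heavy_part X A = \<Union>{U. openin X U \<and> meager_in X (U \<inter> A)}"
    unfolding heavy_part_def using openin_subset by fastforce
  moreover have "openin X (\<Union>{U. openin X U \<and> meager_in X (U \<inter> A)})" by blast
  ultimately show ?thesis unfolding closedin_def heavy_part_def by auto
qed

lemma heavy_part_subset_closure: "heavy_part X A \<subseteq> X closure_of A"
proof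
  fix x assume x: "x \<in> heavy_part X A"
  show "x \<in> X closure_of A"
  proof (rule ccontr)
    assume "x \<notin> X closure_of A"
    then obtain U where U: "openin X U" "x \<in> U" "U \<inter> A = {}"
      using x unfolding heavy_part_def closure_of_def by blast
    have "meager_in X {}" by (simp add: meager_in_closedin)
    with U x show False unfolding heavy_part_def by auto
  qed
qed

text \<open>Each point outside the heavy part has a basic neighbourhood meeting \<open>A\<close> in
  a meager set, and there are only countably many basic sets.\<close>

lemma meager_in_minus_heavy_part:
  assumes "second_countable X" "A \<subseteq> topspace X"
  shows "meager_in X (A - heavy_part X A)"
proof -
  obtain \<B> where \<B>: "countable \<B>" "\<And>V. V \<in> \<B> \<Longrightarrow> openin X V"
    "\<And>U x. openin X U \<Longrightarrow> x \<in> U \<Longrightarrow> \<exists>V\<in>\<B>. x \<in> V \<and> V \<subseteq> U"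
    using assms(1) unfolding second_countable_def by metis
  let ?I = "{V \<in> \<B>. meager_in X (V \<inter> A)}"
  have "meager_in X (\<Union>V\<in>?I. V \<inter> A)"
    by (rule meager_in_UN) (use \<B>(1) in auto)
  moreover have "A - heavy_part X A \<subseteq> (\<Union>V\<in>?I. V \<inter> A)"
  proof
    fix x assume x: "x \<in> A - heavy_part X A"
    then obtain U where U: "openin X U" "x \<in> U" "meager_in X (U \<inter> A)"
      using assms(2) unfolding heavy_part_def by blast
    then obtain V where V: "V \<in> \<B>" "x \<in> V" "V \<subseteq> U" using \<B>(3)[OF U(1,2)] by blast
    have "meager_in X (V \<inter> A)" by (rule meager_in_subset[OF U(3)]) (use V in blast)
    then show "x \<in> (\<Union>V\<in>?I. V \<inter> A)" using V x by blast
  qed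
  ultimately show ?thesis by (rule meager_in_subset)
qed

text \<open>An open set missing the interiors of all the \<open>heavy_part X (A k)\<close> meets
  each \<open>A k\<close> in a meager set, hence also their union. So the heavy part of the union
  lies in the closure of those interiors, and the boundary of an open set is nowhere dense.\<close>

lemma meager_in_heavy_part_UN:
  assumes "second_countable X" "\<And>k :: nat. A k \<subseteq> topspace X"
  shows "meager_in X (heavy_part X (\<Union>k. A k) - (\<Union>k. heavy_part X (A k)))"
proof -
  define W where "W = (\<Union>k. X interior_of (heavy_part X (A k)))"
  have oW: "openin X W" unfolding W_def by (intro openin_Union) auto
  have "heavy_part X (\<Union>k. A k) \<subseteq> X closure_of W"
  proof
    fix x assume x: "x \<in> heavy_part X (\<Union>k. A k)"
    show "x \<in> X closure_of W"
    proof (rule ccontr)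
      assume "x \<notin> X closure_of W"
      then obtain U where U: "openin X U" "x \<in> U" "U \<inter> W = {}"
        using x unfolding heavy_part_def closure_of_def by blast
      have "U \<inter> (\<Union>k. A k) \<subseteq> (\<Union>k. (A k - heavy_part X (A k)) \<union>
          (heavy_part X (A k) - X interior_of (heavy_part X (A k))))"
        using U(3) unfolding W_def by blast
      moreover have "meager_in X (\<Union>k. (A k - heavy_part X (A k)) \<union>
          (heavy_part X (A k) - X interior_of (heavy_part X (A k))))"
        by (intro meager_in_UN meager_in_Un meager_in_minus_heavy_part
            meager_in_closed_minus_interior closedin_heavy_part assms) auto
      ultimately have "meager_in X (U \<inter> (\<Union>k. A k))" by (rule meager_in_subset[rotated])
      with x U show False unfolding heavy_part_def by blast
    qed
  qed
  moreover have "W \<subseteq> (\<Union>k. heavy_part X (A k))"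
    unfolding W_def using interior_of_subset by fastforce
  moreover have "meager_in X (X closure_of W - W)"
  proof (rule meager_in_closedin)
    show "closedin X (X closure_of W - W)" using oW by (simp add: closedin_diff)
    have "X interior_of (X closure_of W - W) \<inter> X closure_of W = {}"
      by (metis (no_types, lifting) Diff_disjoint interior_of_subset disjoint_iff DiffD2 subsetD
          oW openin_interior_of openin_Int_closure_of_eq_empty)
    then show "X interior_of (X closure_of W - W) = {}"
      using interior_of_subset[of X "X closure_of W - W"] by blast
  qed
  ultimately show ?thesis by (elim meager_in_subset) blast
qed

section \<open>Spaces of sequences\<close>

lemma openin_seq_space:
  "openin (product_topology (\<lambda>_. discrete_topology UNIV) (UNIV :: nat set)) U \<longleftrightarrow>
     (\<forall>x\<in>U. \<exists>n. {y. \<forall>i<n. y i = x i} \<subseteq> U)" (is "openin ?T U \<longleftrightarrow> ?R")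
proof
  assume U: "openin ?T U"
  show ?R
  proof
    fix x assume "x \<in> U"
    then obtain V where V: "finite {i. V i \<noteq> UNIV}" "x \<in> Pi\<^sub>E UNIV V" "Pi\<^sub>E UNIV V \<subseteq> U"
      using U unfolding openin_product_topology_alt by fastforce
    obtain n where n: "\<forall>i\<in>{i. V i \<noteq> UNIV}. i < n"
      using V(1) finite_nat_set_iff_bounded by blast
    have "y \<in> U" if "\<forall>i<n. y i = x i" for y
    proof -
      have "y i \<in> V i" for i
        using n V(2) that by (cases "V i = UNIV") (auto simp: PiE_UNIV_domain Pi_iff)
      then show ?thesis using V(3) by (auto simp: PiE_UNIV_domain)
    qed
    then show "\<exists>n. {y. \<forall>i<n. y i = x i} \<subseteq> U" by blast
  qed
next
  assume R: ?R
  show "openin ?T U"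
    unfolding openin_product_topology_alt
  proof
    fix x assume "x \<in> U"
    then obtain n where n: "{y. \<forall>i<n. y i = x i} \<subseteq> U" using R by blast
    let ?V = "\<lambda>i. if i < n then {x i} else UNIV"
    have "{i. ?V i \<noteq> UNIV} \<subseteq> {..<n}" by auto
    then have "finite {i. ?V i \<noteq> UNIV}" by (rule finite_subset) simp
    then show "\<exists>V. finite {i \<in> UNIV. V i \<noteq> topspace (discrete_topology UNIV)} \<and>
        (\<forall>i\<in>UNIV. openin (discrete_topology UNIV) (V i)) \<and> x \<in> Pi\<^sub>E UNIV V \<and> Pi\<^sub>E UNIV V \<subseteq> U"
      using n by (intro exI[of _ ?V]) (auto simp: PiE_UNIV_domain Pi_iff split: if_splits)
  qed
qed

text \<open>
  \<open>S\<close> is the result of the Souslin operation on the closures of the sets \<open>A \<sigma>\<close> below. Off a meager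
  set, membership in the heavy part of \<open>A \<sigma>\<close> passes to the heavy part of some \<open>A (\<sigma> @ [k])\<close>, so a
  point of the heavy part of \<open>S\<close> defines a branch that witnesses its membership in \<open>S\<close>.
\<close>

lemma Sigma11_in_Baire_property:
  assumes X: "second_countable X" and S: "Sigma11_in X S"
  obtains U where "openin X U" "meager_in X ((S - U) \<union> (U - S))"
proof -
  obtain F where F: "closedin (prod_topology X baire_space) F" "S = fst ` F"
    using S unfolding Sigma11_in_def by blast
  have top_baire: "topspace baire_space = UNIV" by (simp add: baire_space_def)
  have subF: "F \<subseteq> topspace X \<times> UNIV" using closedin_subset[OF F(1)] top_baire by simp
  \<comment> \<open>\<open>A \<sigma>\<close> is the projection of the part of \<open>F\<close>
    whose second coordinate extends \<open>\<sigma>\<close>.\<close>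
  define A where "A \<sigma> = {x. \<exists>t. (x, t) \<in> F \<and> (\<forall>i<length \<sigma>. t i = \<sigma> ! i)}" for \<sigma> :: "nat list"
  have Asub: "A \<sigma> \<subseteq> topspace X" for \<sigma> using subF unfolding A_def by blast
  have SA: "S = A []" unfolding A_def F(2) by force
  have A_Un: "A \<sigma> = (\<Union>k. A (\<sigma> @ [k]))" for \<sigma>
  proof
    show "A \<sigma> \<subseteq> (\<Union>k. A (\<sigma> @ [k]))"
    proof
      fix x assume "x \<in> A \<sigma>"
      then obtain t where t: "(x, t) \<in> F" "\<forall>i<length \<sigma>. t i = \<sigma> ! i" unfolding A_def by blast
      then have "x \<in> A (\<sigma> @ [t (length \<sigma>)])"
        unfolding A_def by (auto simp: nth_append less_Suc_eq intro!: exI[of _ t])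
      then show "x \<in> (\<Union>k. A (\<sigma> @ [k]))" by blast
    qed
    show "(\<Union>k. A (\<sigma> @ [k])) \<subseteq> A \<sigma>"
    proof
      fix x assume "x \<in> (\<Union>k. A (\<sigma> @ [k]))"
      then obtain k t where t: "(x, t) \<in> F" "\<And>i. i < Suc (length \<sigma>) \<Longrightarrow> t i = (\<sigma> @ [k]) ! i"
        unfolding A_def by auto
      have "t i = \<sigma> ! i" if "i < length \<sigma>" for i
        using t(2)[of i] that by (simp add: nth_append)
      then show "x \<in> A \<sigma>" using t(1) unfolding A_def by blast
    qed
  qed
  \<comment> \<open>There are countably many finite sequences, so one meager set collects the points
    at which some extension by a digit fails.\<close>
  define M where "M = (\<Union>\<sigma>. heavy_part X (A \<sigma>) - (\<Union>k. heavy_part X (A (\<sigma> @ [k]))))"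
  have "meager_in X (heavy_part X (A \<sigma>) - (\<Union>k. heavy_part X (A (\<sigma> @ [k]))))" for \<sigma>
    using meager_in_heavy_part_UN[OF X, of "\<lambda>k. A (\<sigma> @ [k])"] Asub A_Un[of \<sigma>] by simp
  then have M: "meager_in X M" unfolding M_def by (intro meager_in_UN) auto
  have branch: "heavy_part X S - M \<subseteq> S"
  proof
    fix x assume x: "x \<in> heavy_part X S - M"
    then have xX: "x \<in> topspace X" unfolding heavy_part_def by blast
    have "\<exists>k. x \<in> heavy_part X (A (\<sigma> @ [k]))" if "x \<in> heavy_part X (A \<sigma>)" for \<sigma>
      using x that unfolding M_def by blast
    then obtain g where g: "\<And>\<sigma>. x \<in> heavy_part X (A \<sigma>) \<Longrightarrow> x \<in> heavy_part X (A (\<sigma> @ [g \<sigma>]))"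
      by metis
    \<comment> \<open>Off \<open>M\<close> a heavy sequence always has a heavy one-digit extension;
      iterating this choice from the empty sequence gives the branch \<open>b\<close>.\<close>
    define \<tau> where "\<tau> = rec_nat [] (\<lambda>_ \<sigma>. \<sigma> @ [g \<sigma>])"
    have \<tau>0: "\<tau> 0 = []" and \<tau>S: "\<tau> (Suc n) = \<tau> n @ [g (\<tau> n)]" for n by (simp_all add: \<tau>_def)
    have h: "x \<in> heavy_part X (A (\<tau> n))" for n
      by (induction n) (use x SA g in \<open>auto simp: \<tau>0 \<tau>S\<close>)
    have len: "length (\<tau> n) = n" for n by (induction n) (auto simp: \<tau>0 \<tau>S)
    define b where "b n = g (\<tau> n)" for n
    have nth: "i < n \<Longrightarrow> \<tau> n ! i = b i" for i n
      by (induction n) (auto simp: \<tau>S nth_append len b_def less_Suc_eq)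
    \<comment> \<open>As \<open>F\<close> is closed, it is enough that every rectangle around
      \<open>(x, b)\<close> meets \<open>F\<close>: the heavy part lies in the closure, so every
      neighbourhood of \<open>x\<close> contains a point of \<open>A (\<tau> n)\<close>.\<close>
    have "(x, b) \<in> F"
    proof (rule ccontr)
      assume "(x, b) \<notin> F"
      then have "(x, b) \<in> topspace (prod_topology X baire_space) - F"
        using xX top_baire by simp
      moreover have "openin (prod_topology X baire_space) (topspace (prod_topology X baire_space) - F)"
        using F(1) closedin_def by metis
      ultimately obtain U V where UV: "openin X U" "openin baire_space V" "x \<in> U" "b \<in> V"
        "U \<times> V \<subseteq> topspace (prod_topology X baire_space) - F"
        using openin_prod_topology_alt[THEN iffD1, rule_format] by metis
      obtain n where n: "{t. \<forall>i<n. t i = b i} \<subseteq> V"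
        using UV(2,4) unfolding baire_space_def openin_seq_space by blast
      have "x \<in> X closure_of A (\<tau> n)" by (rule subsetD[OF heavy_part_subset_closure h])
      then obtain y where y: "y \<in> A (\<tau> n)" "y \<in> U" using UV unfolding closure_of_def by blast
      then obtain t where t: "(y, t) \<in> F" "\<forall>i<n. t i = b i" unfolding A_def by (auto simp: len nth)
      then have "t \<in> V" using n by blast
      then have "(y, t) \<notin> F" using subsetD[OF UV(5), of "(y, t)"] y(2) by simp
      then show False using t(1) by contradiction
    qed
    then show "x \<in> S" unfolding F(2) by force
  qed
  define U where "U = X interior_of (heavy_part X S)"
  have "(S - U) \<union> (U - S) \<subseteq> (S - heavy_part X S) \<union> (heavy_part X S - U) \<union> M"
    using branch interior_of_subset[of X "heavy_part X S"] unfolding U_def by blast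
  moreover have "meager_in X ((S - heavy_part X S) \<union> (heavy_part X S - U) \<union> M)"
    unfolding U_def using Asub SA
    by (intro meager_in_Un M meager_in_minus_heavy_part[OF X]
        meager_in_closed_minus_interior closedin_heavy_part) simp
  ultimately have "meager_in X ((S - U) \<union> (U - S))" by (rule meager_in_subset[rotated])
  then show thesis by (intro that[of U]) (simp_all add: U_def)
qed

section \<open>Basic open sets, second countability and Baire category in the space of
  sequences\<close>

definition cyl :: "(nat \<Rightarrow> nat \<Rightarrow> bool) \<Rightarrow> nat \<Rightarrow> (nat \<Rightarrow> nat \<Rightarrow> bool) set" where
  "cyl x n = {y. \<forall>i<n. \<forall>l<n. y i l = x i l}"

lemma cyl_self [simp]: "x \<in> cyl x n"
  by (simp add: cyl_def)

lemma cyl_mono: "n \<le> m \<Longrightarrow> cyl x m \<subseteq> cyl x n"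
  by (auto simp: cyl_def)

lemma cyl_eq: "y \<in> cyl x n \<Longrightarrow> cyl y n = cyl x n"
  by (auto simp: cyl_def)

lemma openin_cantor_seq_space:
  "openin cantor_seq_space U \<longleftrightarrow> (\<forall>x\<in>U. \<exists>n. cyl x n \<subseteq> U)" (is "_ \<longleftrightarrow> ?R")
proof
  assume U: "openin cantor_seq_space U"
  show ?R
  proof
    fix x assume "x \<in> U"
    then obtain V where V: "finite {i. V i \<noteq> UNIV}" "\<And>i. openin cantor_space (V i)"
        "x \<in> Pi\<^sub>E UNIV V" "Pi\<^sub>E UNIV V \<subseteq> U"
      using U unfolding openin_product_topology_alt cantor_seq_space_def
      by (fastforce simp: cantor_space_def)
    have "\<exists>n. {y. \<forall>l<n. y l = x i l} \<subseteq> V i" for i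
      using V(2)[of i] V(3) unfolding cantor_space_def openin_seq_space
      by (auto simp: PiE_UNIV_domain Pi_iff)
    then obtain b where b: "\<And>i. {y. \<forall>l<b i. y l = x i l} \<subseteq> V i" by metis
    \<comment> \<open>One number bounds both rows and columns of a cylinder, so it has to exceed
      each restricted row index and the number of columns constrained in that row.\<close>
    have "finite ((\<lambda>i. max (Suc i) (b i)) ` {i. V i \<noteq> UNIV})" using V(1) by simp
    then obtain n where n: "\<And>i. V i \<noteq> UNIV \<Longrightarrow> max (Suc i) (b i) < n"
      unfolding finite_nat_set_iff_bounded by blast
    have "y \<in> U" if "y \<in> cyl x n" for y
    proof -
      have "y i \<in> V i" for i
      proof (cases "V i = UNIV")
        case False
        then have "i < n" "b i < n" using n[of i] by auto
        then have "\<forall>l<b i. y i l = x i l" using that by (auto simp: cyl_def)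
        then show ?thesis using b[of i] by blast
      qed auto
      then show ?thesis using V(4) by (auto simp: PiE_UNIV_domain)
    qed
    then show "\<exists>n. cyl x n \<subseteq> U" by blast
  qed
next
  assume R: ?R
  show "openin cantor_seq_space U"
    unfolding openin_product_topology_alt cantor_seq_space_def
  proof
    fix x assume "x \<in> U"
    then obtain n where n: "cyl x n \<subseteq> U" using R by blast
    let ?V = "\<lambda>i. if i < n then {y. \<forall>l<n. y l = x i l} else UNIV"
    have "{i. ?V i \<noteq> topspace cantor_space} \<subseteq> {..<n}" by (auto simp: cantor_space_def)
    then have fin: "finite {i. ?V i \<noteq> topspace cantor_space}" by (rule finite_subset) simp
    have op: "openin cantor_space (?V i)" for i
      unfolding cantor_space_def openin_seq_space by (auto intro!: exI[of _ n])
    have "Pi\<^sub>E UNIV ?V \<subseteq> cyl x n"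
    proof
      fix y assume "y \<in> Pi\<^sub>E UNIV ?V"
      then have "y i \<in> ?V i" for i by (simp add: PiE_UNIV_domain Pi_iff)
      then show "y \<in> cyl x n" unfolding cyl_def by (smt (verit) mem_Collect_eq)
    qed
    moreover have "x \<in> Pi\<^sub>E UNIV ?V" by (auto simp: PiE_UNIV_domain)
    ultimately show "\<exists>V. finite {i \<in> UNIV. V i \<noteq> topspace cantor_space} \<and>
        (\<forall>i\<in>UNIV. openin cantor_space (V i)) \<and> x \<in> Pi\<^sub>E UNIV V \<and> Pi\<^sub>E UNIV V \<subseteq> U"
      using n fin op by (intro exI[of _ ?V]) auto
  qed
qed

lemma openin_cyl: "openin cantor_seq_space (cyl x n)"
  unfolding openin_cantor_seq_space using cyl_eq by blast

lemma second_countable_cantor_seq_space: "second_countable cantor_seq_space"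
proof -
  \<comment> \<open>Only the bits in the n by n window matter, so centres with finitely many true
    bits suffice.\<close>
  define \<B> where "\<B> = (\<lambda>(F, n). cyl (\<lambda>i l. (i, l) \<in> F) n) ` ({F. finite F} \<times> (UNIV :: nat set))"
  have "\<exists>V\<in>\<B>. x \<in> V \<and> V \<subseteq> U" if "openin cantor_seq_space U" "x \<in> U" for U x
  proof -
    obtain n where n: "cyl x n \<subseteq> U" using \<open>openin cantor_seq_space U\<close> \<open>x \<in> U\<close> unfolding openin_cantor_seq_space by blast
    let ?F = "{p \<in> {..<n} \<times> {..<n}. x (fst p) (snd p)}"
    have "cyl (\<lambda>i l. (i, l) \<in> ?F) n = cyl x n" by (auto simp: cyl_def)
    moreover have "finite ?F" by (rule finite_subset[of _ "{..<n} \<times> {..<n}"]) auto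
    ultimately have "cyl x n \<in> \<B>" unfolding \<B>_def by (force intro: image_eqI[where x = "(?F, n)"])
    then show ?thesis using n cyl_self[of x n] by blast
  qed
  moreover have "countable \<B>" unfolding \<B>_def by (simp add: countable_Collect_finite)
  moreover have "\<forall>V\<in>\<B>. openin cantor_seq_space V" unfolding \<B>_def using openin_cyl by auto
  ultimately show ?thesis unfolding second_countable_def by blast
qed

lemma Baire_cantor_seq_space:
  assumes "\<And>k :: nat. closedin cantor_seq_space (K k)" "\<And>k. cantor_seq_space interior_of K k = {}"
  shows "cyl x n - (\<Union>k. K k) \<noteq> {}"
proof
  have c: "compact_space cantor_seq_space"
    unfolding cantor_seq_space_def cantor_space_def
    by (simp add: compact_space_product_topology compact_space_discrete_topology)
  have h: "Hausdorff_space cantor_seq_space"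
    unfolding cantor_seq_space_def cantor_space_def
    by (simp add: Hausdorff_space_product_topology)
  have "cantor_seq_space interior_of \<Union>(range K) = {}"
    using c h assms compact_Hausdorff_imp_regular_space compact_imp_locally_compact_space
    by (intro Baire_category_alt) auto
  moreover assume "cyl x n - (\<Union>k. K k) = {}"
  ultimately show False
    using openin_cyl[of x n] interior_of_maximal[of "cyl x n" "\<Union>k. K k"] cyl_self[of x n] by blast
qed

section \<open>Flips\<close>

definition flip :: "(nat \<Rightarrow> nat \<Rightarrow> bool) \<Rightarrow> (nat \<Rightarrow> nat \<Rightarrow> bool) \<Rightarrow> nat \<Rightarrow> nat \<Rightarrow> bool" where
  "flip z x = (\<lambda>i l. z i l \<noteq> x i l)"

text \<open>Flips of whole rows are included in order to move a generic point to an
  \<open>E\<^sub>3\<close>-inequivalent generic point.\<close>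

definition flips :: "(nat \<Rightarrow> nat \<Rightarrow> bool) set" where
  "flips = (\<lambda>(F, R). \<lambda>i l. ((i, l) \<in> F) \<noteq> (i \<in> R)) ` ({F. finite F} \<times> {R. finite R})"

lemma flipsI: "finite F \<Longrightarrow> finite R \<Longrightarrow> (\<lambda>i l. ((i, l) \<in> F) \<noteq> (i \<in> R)) \<in> flips"
  unfolding flips_def by (rule image_eqI[where x = "(F, R)"]) auto

lemma flips_finite: "finite F \<Longrightarrow> (\<lambda>i l. (i, l) \<in> F) \<in> flips"
  using flipsI[of F "{}"] by simp

lemma countable_flips: "countable flips"
  unfolding flips_def by (intro countable_image countable_SIGMA) (auto simp: countable_Collect_finite)

lemma flip_in_flips:
  assumes "z \<in> flips" "w \<in> flips" shows "flip z w \<in> flips"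
proof -
  obtain F R where z: "finite F" "finite R" "z = (\<lambda>i l. ((i, l) \<in> F) \<noteq> (i \<in> R))"
    using assms(1) unfolding flips_def by auto
  obtain G S where w: "finite G" "finite S" "w = (\<lambda>i l. ((i, l) \<in> G) \<noteq> (i \<in> S))"
    using assms(2) unfolding flips_def by auto
  have "flip z w = (\<lambda>i l. ((i, l) \<in> sym_diff F G) \<noteq> (i \<in> sym_diff R S))"
    unfolding flip_def z(3) w(3) by (intro ext) auto
  then show ?thesis using flipsI[of "sym_diff F G" "sym_diff R S"] z w by simp
qed

lemma flip_flip: "flip z (flip w x) = flip (flip z w) x"
  unfolding flip_def by (intro ext) blast

lemma flip_self [simp]: "flip z (flip z x) = x"
  unfolding flip_def by (intro ext) blast

lemma flip_cyl: "y \<in> cyl x n \<Longrightarrow> flip z y \<in> cyl (flip z x) n"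
  by (auto simp: flip_def cyl_def)

lemma homeomorphic_map_flip: "homeomorphic_map cantor_seq_space cantor_seq_space (flip z)"
proof (rule homeomorphic_map_involution)
  show "continuous_map cantor_seq_space cantor_seq_space (flip z)"
    unfolding continuous_map_def openin_cantor_seq_space
  proof (intro conjI allI impI ballI)
    fix U x
    assume U: "\<forall>x\<in>U. \<exists>n. cyl x n \<subseteq> U"
      and "x \<in> {x \<in> topspace cantor_seq_space. flip z x \<in> U}"
    then obtain n where "cyl (flip z x) n \<subseteq> U" by blast
    then show "\<exists>n. cyl x n \<subseteq> {x \<in> topspace cantor_seq_space. flip z x \<in> U}"
      using flip_cyl by (intro exI[of _ n]) auto
  qed simp
qed simp

text \<open>\<open>flips\<close> is a countable group of homeomorphisms under composition, so all
  images of the closed nowhere dense sets covering \<open>M\<close> still form a countable family,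
  now with an invariant union.\<close>

lemma comeager_flip_invariant:
  assumes "meager_in cantor_seq_space M"
  obtains K :: "nat \<Rightarrow> (nat \<Rightarrow> nat \<Rightarrow> bool) set"
  where "\<And>k. closedin cantor_seq_space (K k)" "\<And>k. cantor_seq_space interior_of K k = {}"
    "M \<subseteq> (\<Union>k. K k)" "\<And>z x. z \<in> flips \<Longrightarrow> x \<notin> (\<Union>k. K k) \<Longrightarrow> flip z x \<notin> (\<Union>k. K k)"
proof -
  obtain L :: "nat \<Rightarrow> (nat \<Rightarrow> nat \<Rightarrow> bool) set" where
    L: "\<And>k. closedin cantor_seq_space (L k)" "\<And>k. cantor_seq_space interior_of L k = {}" "M \<subseteq> (\<Union>k. L k)"
    using assms unfolding meager_in_iff by blast
  define \<K> where "\<K> = (\<lambda>(z, k). flip z ` L k) ` (flips \<times> UNIV)"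
  have zero: "(\<lambda>i l. False) \<in> flips" using flips_finite[of "{}"] by simp
  have c: "countable \<K>" unfolding \<K>_def by (intro countable_image countable_SIGMA countable_flips) auto
  have ne: "\<K> \<noteq> {}" using zero unfolding \<K>_def by blast
  have U: "(\<Union>k. from_nat_into \<K> k) = \<Union>\<K>" using range_from_nat_into[OF ne c] by simp
  have mem: "x \<in> \<Union>\<K> \<longleftrightarrow> (\<exists>z\<in>flips. \<exists>k. flip z x \<in> L k)" for x
    unfolding \<K>_def by (auto, metis flip_self, metis flip_self imageI)
  have nd: "closedin cantor_seq_space A" "cantor_seq_space interior_of A = {}" if AK: "A \<in> \<K>" for A
  proof -
    obtain z k where A: "A = flip z ` L k" using AK unfolding \<K>_def by auto
    show "closedin cantor_seq_space A"
      using L(1) homeomorphic_map_closedness_eq[OF homeomorphic_map_flip] A by blast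
    show "cantor_seq_space interior_of A = {}"
      using homeomorphic_map_interior_of[OF homeomorphic_map_flip[of z], of "L k"] L(2) A by simp
  qed
  show thesis
  proof (rule that[of "from_nat_into \<K>"])
    show "M \<subseteq> (\<Union>k. from_nat_into \<K> k)"
    proof
      fix x assume "x \<in> M"
      then obtain k where "x \<in> L k" using L(3) by blast
      then have "flip (\<lambda>i l. False) x \<in> L k" by (simp add: flip_def)
      then show "x \<in> (\<Union>k. from_nat_into \<K> k)" unfolding U mem using zero by blast
    qed
    show "flip z x \<notin> (\<Union>k. from_nat_into \<K> k)"
      if "z \<in> flips" "x \<notin> (\<Union>k. from_nat_into \<K> k)" for z x
      using that flip_in_flips unfolding U mem flip_flip by blast
  qed (use nd from_nat_into[OF ne] in auto)
qed

section \<open>Separating \<open>E\<^sub>3\<close>-classes by \<open>E\<^sub>0\<close>-classes\<close>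

text \<open>Stage \<open>k\<close> freezes the window of size \<open>n k\<close>, and these windows
  exhaust all positions.\<close>

lemma nested_cyl_limit:
  assumes step: "\<And>k. x (Suc k) \<in> cyl (x k) (n k)" and n: "\<And>k. n k < n (Suc k)"
  obtains y where "\<And>k. y \<in> cyl (x k) (n k)"
proof -
  have mono: "strict_mono n" using n by (rule strict_monoI_Suc)
  have up: "x m \<in> cyl (x k) (n k)" if "k \<le> m" for k m
    using that
  proof (induction m rule: dec_induct)
    case (step m)
    have "x (Suc m) \<in> cyl (x m) (n k)"
      using assms(1)[of m] cyl_mono[of "n k" "n m"] strict_mono_mono[OF mono] step(1)
      by (meson monoD subsetD)
    with step.IH show ?case using cyl_eq by blast
  qed simp
  \<comment> \<open>The window at stage \<open>m\<close> has size at least \<open>m\<close>, so the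
    bit at \<open>(i, l)\<close> is already frozen at stage \<open>Suc (max i l)\<close>.\<close>
  define y where "y i l = x (Suc (max i l)) i l" for i l
  have "y \<in> cyl (x k) (n k)" for k
    unfolding cyl_def
  proof safe
    fix i l assume il: "i < n k" "l < n k"
    let ?m = "Suc (max i l)"
    have "?m \<le> n ?m" using mono by (rule strict_mono_imp_increasing)
    then have il': "i < n ?m" "l < n ?m" by auto
    have "x ?m i l = x k i l"
    proof (cases "k \<le> ?m")
      case True
      then show ?thesis using up[of k ?m] il by (simp add: cyl_def)
    next
      case False
      then show ?thesis using up[of ?m k] il' by (simp add: cyl_def)
    qed
    then show "y i l \<Longrightarrow> x k i l" "x k i l \<Longrightarrow> y i l" by (simp_all add: y_def)
  qed
  then show thesis using that by blast
qed

section \<open>Maps continuous on a comeager set, and the fusion argument\<close>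

definition continuous_relative ::
    "(nat \<Rightarrow> nat \<Rightarrow> bool) set \<Rightarrow> ((nat \<Rightarrow> nat \<Rightarrow> bool) \<Rightarrow> nat \<Rightarrow> bool) \<Rightarrow> bool" where
  "continuous_relative C f \<longleftrightarrow> (\<forall>x\<in>C. \<forall>j. \<exists>n. \<forall>y\<in>C \<inter> cyl x n. f y j = f x j)"

lemma continuous_relativeD:
  assumes "continuous_relative C f" "x \<in> C"
  obtains n where "n \<ge> m" "\<And>y j. y \<in> C \<Longrightarrow> y \<in> cyl x n \<Longrightarrow> j < p \<Longrightarrow> f y j = f x j"
proof -
  have "\<forall>j. \<exists>n. \<forall>y\<in>C \<inter> cyl x n. f y j = f x j"
    using assms unfolding continuous_relative_def by blast
  then obtain b where b: "\<And>j y. y \<in> C \<Longrightarrow> y \<in> cyl x (b j) \<Longrightarrow> f y j = f x j" by (metis IntI)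
  define n where "n = Max (insert m (b ` {..<p}))"
  have "m \<le> n" unfolding n_def by simp
  moreover have "f y j = f x j" if "y \<in> C" "y \<in> cyl x n" "j < p" for y j
  proof -
    have "b j \<le> n" unfolding n_def using that by simp
    then show ?thesis using b[OF that(1)] cyl_mono that(2) by blast
  qed
  ultimately show thesis using that by blast
qed

text \<open>The closed sets \<open>K k\<close> stay explicit because the fusion enters
  \<open>C\<close> by avoiding them a few at a time.\<close>

locale generic_map =
  fixes K :: "nat \<Rightarrow> (nat \<Rightarrow> nat \<Rightarrow> bool) set"
    and C :: "(nat \<Rightarrow> nat \<Rightarrow> bool) set"
    and f :: "(nat \<Rightarrow> nat \<Rightarrow> bool) \<Rightarrow> nat \<Rightarrow> bool"
  assumes C_def: "C = - (\<Union>k. K k)"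
    and closed_K: "closedin cantor_seq_space (K k)"
    and C_flip: "z \<in> flips \<Longrightarrow> x \<in> C \<Longrightarrow> flip z x \<in> C"
    and C_dense: "C \<inter> cyl s n \<noteq> {}"
    and cont: "continuous_relative C f"
    and hom: "(x, y) \<in> E3 \<Longrightarrow> (f x, f y) \<in> E0"
begin

text \<open>A triple stands for a pair of cylinders of size \<open>n\<close>. Agreement of the first
  \<open>n\<close> rows beyond column \<open>n\<close> makes the two limits
  \<open>E3\<close>-equivalent, avoidance of the \<open>K k\<close> puts them in \<open>C\<close>,
  and the last clause separates their images at arbitrarily large coordinates.\<close>

definition fusion_step :: "_ \<Rightarrow> _ \<Rightarrow> bool" where
  "fusion_step = (\<lambda>(x, y, n) (x', y', n'). x' \<in> cyl x n \<and> y' \<in> cyl y n \<and> n < n' \<and>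
     (\<forall>i<n. \<forall>l\<ge>n. x' i l = y' i l) \<and>
     (\<forall>a \<in> cyl x' n' \<union> cyl y' n'. \<forall>k\<le>n. a \<notin> K k) \<and>
     (\<exists>j\<ge>n. \<forall>a \<in> C \<inter> cyl x' n'. \<forall>b \<in> C \<inter> cyl y' n'. f a j \<noteq> f b j))"

lemma avoid_K:
  assumes "x \<in> C"
  obtains n where "n \<ge> m" "\<And>a k. a \<in> cyl x n \<Longrightarrow> k \<le> p \<Longrightarrow> a \<notin> K k"
proof -
  have "\<exists>n. cyl x n \<subseteq> - K k" for k
  proof -
    have "openin cantor_seq_space (- K k)"
      using closed_K[of k] by (simp add: closedin_def Compl_eq_Diff_UNIV)
    moreover have "x \<in> - K k" using assms C_def by blast
    ultimately show ?thesis unfolding openin_cantor_seq_space by blast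
  qed
  then obtain b where b: "\<And>k. cyl x (b k) \<subseteq> - K k" by metis
  define n where "n = Max (insert m (b ` {..p}))"
  have "m \<le> n" unfolding n_def by simp
  moreover have "a \<notin> K k" if "a \<in> cyl x n" "k \<le> p" for a k
  proof -
    have "b k \<le> n" unfolding n_def by (rule Max_ge) (use that in auto)
    then show ?thesis using b[of k] cyl_mono that(1) by blast
  qed
  ultimately show thesis using that by blast
qed

text \<open>The bad pair lies in a single cylinder around \<open>x\<close>. A finite flip carries a
  copy of \<open>a\<close> to the cylinder around \<open>y\<close>, and one of \<open>a\<close>,
  \<open>b\<close> has an image differing from that of the copy at \<open>j\<close>.\<close>

lemma fusion_step_exists:
  assumes C: "x \<in> C" "y \<in> C"
    and bad: "a \<in> C \<inter> cyl x n" "b \<in> C \<inter> cyl x n" "\<forall>i<n. a i = b i" "j \<ge> n" "f a j \<noteq> f b j"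
  shows "\<exists>x' y' n'. x' \<in> C \<and> y' \<in> C \<and> fusion_step (x, y, n) (x', y', n')"
proof -
  \<comment> \<open>Flipping by \<open>z\<close> turns the window of \<open>x\<close> into that of
    \<open>y\<close> and changes nothing outside the window.\<close>
  define z where "z = (\<lambda>i l. (i, l) \<in> {p \<in> {..<n} \<times> {..<n}. x (fst p) (snd p) \<noteq> y (fst p) (snd p)})"
  have "finite {p \<in> {..<n} \<times> {..<n}. x (fst p) (snd p) \<noteq> y (fst p) (snd p)}"
    by (rule finite_subset[of _ "{..<n} \<times> {..<n}"]) auto
  then have z: "z \<in> flips" unfolding z_def by (rule flips_finite)
  define y' where "y' = flip z a"
  have y': "y' \<in> C" "y' \<in> cyl y n"
    using C_flip[OF z] bad by (auto simp: y'_def cyl_def flip_def z_def)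
  \<comment> \<open>Bits take two values, so \<open>f a j\<close> and \<open>f b j\<close> cannot
    both equal \<open>f y' j\<close>. Either choice agrees with \<open>a\<close> on the first
    \<open>n\<close> rows.\<close>
  obtain x' where x': "x' \<in> C" "x' \<in> cyl x n" "f x' j \<noteq> f y' j" "\<forall>i<n. x' i = a i"
    using bad by (cases "f y' j = f a j") auto
  have agree: "\<forall>i<n. \<forall>l\<ge>n. x' i l = y' i l"
    using x'(4) by (simp add: y'_def flip_def z_def)
  obtain n1 where n1: "n1 \<ge> Suc n" "\<And>a k. a \<in> cyl x' n1 \<Longrightarrow> k \<le> n \<Longrightarrow> a \<notin> K k"
    using avoid_K[OF x'(1), of "Suc n" n] by blast
  obtain n2 where n2: "n2 \<ge> n1" "\<And>a k. a \<in> cyl y' n2 \<Longrightarrow> k \<le> n \<Longrightarrow> a \<notin> K k"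
    using avoid_K[OF y'(1), of n1 n] by blast
  obtain n3 where n3: "n3 \<ge> n2" "\<And>a. a \<in> C \<Longrightarrow> a \<in> cyl x' n3 \<Longrightarrow> f a j = f x' j"
    using continuous_relativeD[OF cont x'(1), of n2 "Suc j"] by (metis lessI)
  obtain n4 where n4: "n4 \<ge> n3" "\<And>a. a \<in> C \<Longrightarrow> a \<in> cyl y' n4 \<Longrightarrow> f a j = f y' j"
    using continuous_relativeD[OF cont y'(1), of n3 "Suc j"] by (metis lessI)
  have sub: "cyl x' n4 \<subseteq> cyl x' n1" "cyl x' n4 \<subseteq> cyl x' n3" "cyl y' n4 \<subseteq> cyl y' n2"
    using n1(1) n2(1) n3(1) n4(1) by (auto intro!: cyl_mono)
  have "fusion_step (x, y, n) (x', y', n4)"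
    unfolding fusion_step_def prod.case
  proof (intro conjI)
    show "\<forall>a\<in>cyl x' n4 \<union> cyl y' n4. \<forall>k\<le>n. a \<notin> K k" using n1(2) n2(2) sub by blast
    show "\<exists>j\<ge>n. \<forall>a\<in>C \<inter> cyl x' n4. \<forall>b\<in>C \<inter> cyl y' n4. f a j \<noteq> f b j"
      using n3(2) n4(2) x'(3) bad(4) sub by (intro exI[of _ j]) (metis IntD1 IntD2 subsetD)
  qed (use x' y' agree n1(1) n2(1) n3(1) n4(1) in auto)
  then show ?thesis using x' y' by blast
qed

text \<open>Otherwise a fusion produces \<open>E\<^sub>3\<close>-equivalent points of \<open>C\<close> with \<open>E\<^sub>0\<close>-inequivalent images.\<close>

lemma uniform_agreement:
  "\<exists>s n. \<forall>a \<in> C \<inter> cyl s n. \<forall>b \<in> C \<inter> cyl s n.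
     (\<forall>i<n. a i = b i) \<longrightarrow> (a, b) \<in> E3 \<longrightarrow> (\<forall>j\<ge>n. f a j = f b j)"
proof (rule ccontr)
  assume neg: "\<not> ?thesis"
  have ex: "\<exists>q. (fst q \<in> C \<and> fst (snd q) \<in> C) \<and> fusion_step p q"
    if "fst p \<in> C \<and> fst (snd p) \<in> C" for p
  proof -
    obtain x y n where p: "p = (x, y, n)" by (cases p)
    obtain a b j where "a \<in> C \<inter> cyl x n" "b \<in> C \<inter> cyl x n" "\<forall>i<n. a i = b i" "j \<ge> n" "f a j \<noteq> f b j"
      using neg by blast
    from fusion_step_exists[OF _ _ this] that p show ?thesis by fastforce
  qed
  obtain c where c: "c \<in> C" using C_dense by blast
  have "\<exists>S. \<forall>k. (fst (S k) \<in> C \<and> fst (snd (S k)) \<in> C) \<and> fusion_step (S k) (S (Suc k))"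
    by (rule dependent_nat_choice[of "\<lambda>_ p. fst p \<in> C \<and> fst (snd p) \<in> C" "\<lambda>_. fusion_step"])
      (use c ex in \<open>auto intro!: exI[of _ c]\<close>)
  then obtain S where S: "\<And>k. fusion_step (S k) (S (Suc k))" by blast
  define X where "X k = fst (S k)" for k
  define Y where "Y k = fst (snd (S k))" for k
  define n where "n k = snd (snd (S k))" for k
  have st: "fusion_step (X k, Y k, n k) (X (Suc k), Y (Suc k), n (Suc k))" for k
    using S[of k] by (simp add: X_def Y_def n_def)
  have Xs: "X (Suc k) \<in> cyl (X k) (n k)" and Ys: "Y (Suc k) \<in> cyl (Y k) (n k)"
    and ns: "n k < n (Suc k)"
    and rows: "i < n k \<Longrightarrow> l \<ge> n k \<Longrightarrow> X (Suc k) i l = Y (Suc k) i l"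
    and K: "a \<in> cyl (X (Suc k)) (n (Suc k)) \<union> cyl (Y (Suc k)) (n (Suc k)) \<Longrightarrow> m \<le> n k \<Longrightarrow> a \<notin> K m"
    and sep: "\<exists>j\<ge>n k. \<forall>a \<in> C \<inter> cyl (X (Suc k)) (n (Suc k)).
        \<forall>b \<in> C \<inter> cyl (Y (Suc k)) (n (Suc k)). f a j \<noteq> f b j" for k i l a m
    using st[of k] unfolding fusion_step_def by auto
  obtain x where x: "\<And>k. x \<in> cyl (X k) (n k)" using nested_cyl_limit[of X n, OF Xs ns] by blast
  obtain y where y: "\<And>k. y \<in> cyl (Y k) (n k)" using nested_cyl_limit[of Y n, OF Ys ns] by blast
  have mono: "strict_mono n" using ns by (rule strict_monoI_Suc)
  have le: "k \<le> n k" for k using mono by (rule strict_mono_imp_increasing)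
  \<comment> \<open>Stage \<open>m\<close> suffices to avoid \<open>K m\<close>, since
    \<open>m \<le> n m\<close>.\<close>
  have xC: "x \<in> C" and yC: "y \<in> C"
    unfolding C_def using K x y le by blast+
  \<comment> \<open>The columns from \<open>n k\<close> on split into blocks between
    \<open>n m\<close> and \<open>n (Suc m)\<close>; step \<open>m\<close> makes row
    \<open>i\<close> agree there and its new window freezes the block.\<close>
  have agree: "x i l = y i l" if i: "i < n k" and l: "n k \<le> l" for i k l
  proof -
    have *: "n k \<le> l \<longrightarrow> l < n m \<longrightarrow> x i l = y i l" if "k \<le> m" for m
      using that
    proof (induction m rule: dec_induct)
      case base
      then show ?case by auto
    next
      case (step m)
      have "n k \<le> n m" using step(1) strict_mono_mono[OF mono] by (simp add: monoD)
      then have im: "i < n m" using i by simp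
      have "x i l = y i l" if "n m \<le> l" "l < n (Suc m)"
      proof -
        have "x i l = X (Suc m) i l" "y i l = Y (Suc m) i l"
          using x[of "Suc m"] y[of "Suc m"] im that(2) ns[of m] by (auto simp: cyl_def)
        then show ?thesis using rows[OF im that(1)] by simp
      qed
      then show ?case using step.IH by (meson not_le)
    qed
    have "l < n (max k (Suc l))" using le[of "Suc l"] strict_mono_mono[OF mono]
      by (meson Suc_le_eq dual_order.trans max.cobounded2 monoD)
    then show ?thesis using *[of "max k (Suc l)"] l by simp
  qed
  have "(x i, y i) \<in> E0" for i
  proof -
    have "i < n (Suc i)" using le[of "Suc i"] by simp
    then have "\<forall>l>n (Suc i). x i l = y i l" using agree by simp
    then show ?thesis unfolding E0_def by blast
  qed
  then have "(f x, f y) \<in> E0" by (intro hom) (simp add: E3_def)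
  then obtain N where N: "\<forall>j>N. f x j = f y j" unfolding E0_def by blast
  \<comment> \<open>Stage \<open>Suc N\<close> forces \<open>j > N\<close>, where the images should
    already agree.\<close>
  obtain j where "j \<ge> n (Suc N)" "f x j \<noteq> f y j"
    using sep[of "Suc N"] x y xC yC by blast
  then show False using N le[of "Suc N"] by auto
qed

lemma identifies_inequivalent_points: "\<exists>x y. f x = f y \<and> (x, y) \<notin> E3"
proof -
  obtain s n where sn: "\<And>a b j. a \<in> C \<Longrightarrow> a \<in> cyl s n \<Longrightarrow> b \<in> C \<Longrightarrow> b \<in> cyl s n \<Longrightarrow>
     (\<forall>i<n. a i = b i) \<Longrightarrow> (a, b) \<in> E3 \<Longrightarrow> j \<ge> n \<Longrightarrow> f a j = f b j"
    using uniform_agreement by (metis IntI)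
  obtain x where x: "x \<in> C" "x \<in> cyl s n" using C_dense by blast
  \<comment> \<open>Uniform agreement controls the coordinates of \<open>f\<close> from
    \<open>n\<close> on; continuity at \<open>x\<close> controls the first \<open>n\<close>.
    Together they fix the whole image.\<close>
  obtain N where N: "N \<ge> n" "\<And>a j. a \<in> C \<Longrightarrow> a \<in> cyl x N \<Longrightarrow> j < n \<Longrightarrow> f a j = f x j"
    using continuous_relativeD[OF cont x(1)] by blast
  have const: "f a = f x" if "a \<in> C" "a \<in> cyl x N" "\<forall>i<n. a i = x i" "(a, x) \<in> E3" for a
  proof
    fix j
    have "a \<in> cyl s n" using that(2) x(2) cyl_mono[OF N(1)] cyl_eq by blast
    then show "f a j = f x j" using sn[OF that(1) _ x that(3,4)] N(2)[OF that(1,2)] by (meson not_le)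
  qed
  \<comment> \<open>Row \<open>n\<close> is the first row left free by uniform agreement. Flipping
    an infinite tail of it destroys \<open>E3\<close>-equivalence.\<close>
  define y where "y = flip (\<lambda>i l. i = n \<and> N \<le> l) x"
  \<comment> \<open>A tail is a whole row corrected at finitely many columns, so flipping it
    preserves \<open>C\<close>.\<close>
  have "(\<lambda>i l. i = n \<and> N \<le> l) = (\<lambda>i l. ((i, l) \<in> {n} \<times> {..<N}) \<noteq> (i \<in> {n}))"
    by (intro ext) auto
  then have yC: "y \<in> C" unfolding y_def using C_flip[OF flipsI x(1), of "{n} \<times> {..<N}" "{n}"] by simp
  have "f x j = f y j" for j
  proof -
    obtain M where M: "\<forall>a\<in>C \<inter> cyl y M. f a j = f y j"
      using cont yC unfolding continuous_relative_def by blast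
    \<comment> \<open>Stopping the flip at column \<open>M\<close> changes only finitely many bits
      of \<open>x\<close>, so \<open>const\<close> applies, yet \<open>a\<close> looks like
      \<open>y\<close> on the window of size \<open>M\<close>, which decides coordinate
      \<open>j\<close> of the image.\<close>
    define a where "a = flip (\<lambda>i l. (i, l) \<in> {n} \<times> {N..<M}) x"
    have aC: "a \<in> C" unfolding a_def by (rule C_flip[OF flips_finite x(1)]) simp
    have "(a i, x i) \<in> E0" for i
      unfolding E0_def by (auto simp: a_def flip_def intro!: exI[of _ M])
    then have "(a, x) \<in> E3" by (simp add: E3_def)
    moreover have "a \<in> cyl x N" "\<forall>i<n. a i = x i" "a \<in> cyl y M"
      by (auto simp: a_def y_def flip_def cyl_def)
    ultimately have "f a = f x" "f a j = f y j" using const aC M by blast+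
    then show ?thesis by simp
  qed
  then have "f x = f y" by (rule ext)
  moreover have "(x, y) \<notin> E3"
  proof
    assume "(x, y) \<in> E3"
    then obtain m where "\<forall>l>m. x n l = y n l" unfolding E3_def E0_def by blast
    then have "x n (Suc (max m N)) = y n (Suc (max m N))" by simp
    moreover have "N \<le> Suc (max m N)" by simp
    ultimately show False unfolding y_def flip_def by blast
  qed
  ultimately show ?thesis by blast
qed

end

section \<open>Failure of the Mycielski property\<close>

text \<open>Both \<open>S\<close> and its complement are open modulo a meager set. Having both open
  sets makes membership in \<open>S\<close> continuous off a single meager set.\<close>

lemma Delta11_in_Baire_property:
  assumes "second_countable X" "Delta11_in X S"
  obtains U V where "openin X U" "openin X V"
    "meager_in X ((S - U) \<union> (U - S) \<union> ((topspace X - S - V) \<union> (V - (topspace X - S))))"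
proof -
  obtain U where "openin X U" "meager_in X ((S - U) \<union> (U - S))"
    using Sigma11_in_Baire_property assms unfolding Delta11_in_def by metis
  moreover obtain V where
    "openin X V" "meager_in X ((topspace X - S - V) \<union> (V - (topspace X - S)))"
    using Sigma11_in_Baire_property assms unfolding Delta11_in_def by metis
  ultimately show thesis using that meager_in_Un by blast
qed

text \<open>The coordinates of \<open>f\<close> are countably many, so their exceptional sets fit
  into one meager set; the complement of a flip-invariant enlargement of it serves as
  \<open>C\<close>.\<close>

lemma no_separating_map:
  assumes meas: "\<And>j. Delta11_in cantor_seq_space {x. f x j}"
    and hom: "\<And>x y. (x, y) \<in> E3 \<Longrightarrow> (f x, f y) \<in> E0"
  shows "\<exists>x y. f x = f y \<and> (x, y) \<notin> E3"
proof -
  define S where "S j = {x. f x j}" for j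
  have "\<exists>U V. openin cantor_seq_space U \<and> openin cantor_seq_space V \<and>
     meager_in cantor_seq_space ((S j - U) \<union> (U - S j) \<union> ((- S j - V) \<union> (V - - S j)))" for j
    using Delta11_in_Baire_property[OF second_countable_cantor_seq_space meas[of j]]
    unfolding S_def topspace_cantor_seq_space Compl_eq_Diff_UNIV by metis
  then obtain U V where UV: "\<And>j. openin cantor_seq_space (U j)" "\<And>j. openin cantor_seq_space (V j)"
    "\<And>j. meager_in cantor_seq_space ((S j - U j) \<union> (U j - S j) \<union> ((- S j - V j) \<union> (V j - - S j)))"
    by metis
  define M where "M = (\<Union>j. (S j - U j) \<union> (U j - S j) \<union> ((- S j - V j) \<union> (V j - - S j)))"
  have "meager_in cantor_seq_space M" unfolding M_def by (intro meager_in_UN UV(3)) simp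
  then obtain K :: "nat \<Rightarrow> (nat \<Rightarrow> nat \<Rightarrow> bool) set" where
    K: "\<And>k. closedin cantor_seq_space (K k)" "\<And>k. cantor_seq_space interior_of K k = {}"
      "M \<subseteq> (\<Union>k. K k)" "\<And>z x. z \<in> flips \<Longrightarrow> x \<notin> (\<Union>k. K k) \<Longrightarrow> flip z x \<notin> (\<Union>k. K k)"
    using comeager_flip_invariant by blast
  define C where "C = - (\<Union>k. K k)"
  have CM: "x \<in> U j \<longleftrightarrow> f x j" "x \<in> V j \<longleftrightarrow> \<not> f x j" if "x \<in> C" for x j
  proof -
    have "x \<notin> M" using that K(3) C_def by blast
    then show "x \<in> U j \<longleftrightarrow> f x j" "x \<in> V j \<longleftrightarrow> \<not> f x j" unfolding M_def S_def by auto
  qed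
  have "continuous_relative C f"
    unfolding continuous_relative_def
  proof (intro ballI allI)
    fix x j assume x: "x \<in> C"
    have "\<exists>n. cyl x n \<subseteq> (if f x j then U j else V j)"
      using UV(1,2)[of j] CM[OF x, of j] unfolding openin_cantor_seq_space by auto
    then obtain n where n: "cyl x n \<subseteq> (if f x j then U j else V j)" by blast
    show "\<exists>n. \<forall>y\<in>C \<inter> cyl x n. f y j = f x j"
    proof (intro exI ballI)
      fix y assume y: "y \<in> C \<inter> cyl x n"
      then have "y \<in> (if f x j then U j else V j)" using n by blast
      then show "f y j = f x j" using CM[of y j] y by (auto split: if_splits)
    qed
  qed
  moreover have "C \<inter> cyl s n \<noteq> {}" for s n
    using Baire_cantor_seq_space[of K s n, OF K(1,2)] by (simp add: C_def Diff_eq Int_commute)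
  moreover have "flip z x \<in> C" if "z \<in> flips" "x \<in> C" for z x
    using K(4)[of z x] that unfolding C_def by blast
  ultimately interpret generic_map K C f
    by unfold_locales (use K(1) hom in \<open>auto simp: C_def\<close>)
  show ?thesis by (rule identifies_inequivalent_points)
qed

lemma inequivalent_tuples_not_subset_D:
  assumes red: "Delta11_reducible cantor_seq_space E3 (subtopology cantor_seq_space B) (Restr E3 B)"
  shows "\<not> inequivalent_tuples E3 2 B \<subseteq> D"
proof
  assume sub: "inequivalent_tuples E3 2 B \<subseteq> D"
  obtain \<Phi> where \<Phi>: "Delta11_map cantor_seq_space (subtopology cantor_seq_space B) \<Phi>"
    "\<And>a b. (a, b) \<in> E3 \<longleftrightarrow> (\<Phi> a, \<Phi> b) \<in> Restr E3 B"
    using red unfolding Delta11_reducible_def by auto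
  have B: "\<Phi> x \<in> B" for x using \<Phi>(1) unfolding Delta11_map_def by auto
  have "Delta11_in cantor_seq_space {x. \<Phi> x 0 j}" for j
  proof -
    have "openin cantor_seq_space {z. z 0 j}"
      unfolding openin_cantor_seq_space by (auto simp: cyl_def intro!: exI[of _ "Suc j"])
    then have "openin (subtopology cantor_seq_space B) (B \<inter> {z. z 0 j})"
      by (rule openin_subtopology_Int2)
    then have "Delta11_in cantor_seq_space {x \<in> topspace cantor_seq_space. \<Phi> x \<in> B \<inter> {z. z 0 j}}"
      using \<Phi>(1) unfolding Delta11_map_def by blast
    then show ?thesis using B by simp
  qed
  moreover have "(\<Phi> x 0, \<Phi> y 0) \<in> E0" if "(x, y) \<in> E3" for x y
    using \<Phi>(2) that unfolding E3_def by blast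
  ultimately have "\<exists>x y. \<Phi> x 0 = \<Phi> y 0 \<and> (x, y) \<notin> E3"
    by (rule no_separating_map)
  then obtain x y where xy: "\<Phi> x 0 = \<Phi> y 0" "(x, y) \<notin> E3" by blast
  \<comment> \<open>The pair of images as a point of the square; \<open>restrict\<close> supplies
    the value \<open>undefined\<close> beyond the two indices.\<close>
  define p where "p = (\<lambda>i\<in>{..<2::nat}. if i = 0 then \<Phi> x else \<Phi> y)"
  have "(\<Phi> x, \<Phi> y) \<notin> E3" using xy(2) \<Phi>(2) B by blast
  moreover have "sym E3" using equiv_E3 unfolding equiv_def by blast
  ultimately have "(\<Phi> y, \<Phi> x) \<notin> E3" by (meson symD)
  then have "p \<in> inequivalent_tuples E3 2 B"
    using \<open>(\<Phi> x, \<Phi> y) \<notin> E3\<close> B unfolding inequivalent_tuples_def p_def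
    by (auto simp: less_2_cases_iff)
  then have "p \<in> D" using sub by blast
  then show False using xy(1) by (simp add: D_def p_def)
qed

section \<open>Openness and density of \<open>D\<close>\<close>

lemma openin_D: "openin (power_topology 2 cantor_seq_space) D"
proof -
  define P where "P i j b = {p \<in> topspace (power_topology 2 cantor_seq_space). p i \<in> {z. z 0 j = b}}"
    for i j :: nat and b
  \<comment> \<open>Two binary sequences differ exactly when some bit \<open>j\<close> is
    \<open>b\<close> in one and its negation in the other.\<close>
  have "D = (\<Union>j. \<Union>b. P 0 j b \<inter> P 1 j (\<not> b))"
    unfolding D_def P_def by (auto simp: fun_eq_iff)
  moreover have P: "openin (power_topology 2 cantor_seq_space) (P i j b)" if "i < 2" for i j b
    unfolding P_def
  proof (rule openin_continuous_map_preimage)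
    show "continuous_map (power_topology 2 cantor_seq_space) cantor_seq_space (\<lambda>p. p i)"
      unfolding power_topology_def using that by (intro continuous_map_product_projection) simp
    show "openin cantor_seq_space {z. z 0 j = b}"
      unfolding openin_cantor_seq_space by (auto simp: cyl_def intro!: exI[of _ "Suc j"])
  qed
  moreover have "openin (power_topology 2 cantor_seq_space) (\<Union>j. \<Union>b. P 0 j b \<inter> P 1 j (\<not> b))"
    by (intro openin_Union) (auto intro!: openin_Int P)
  ultimately show ?thesis by simp
qed

lemma closure_of_D:
  "power_topology 2 cantor_seq_space closure_of D = topspace (power_topology 2 cantor_seq_space)"
proof (rule subset_antisym[OF closure_of_subset_topspace], rule subsetI)
  fix p assume p: "p \<in> topspace (power_topology 2 cantor_seq_space)"
  have "\<exists>q\<in>D. q \<in> T" if T: "openin (power_topology 2 cantor_seq_space) T" "p \<in> T" for T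
  proof (cases "p \<in> D")
    case False
    then have eq: "p 0 0 = p 1 0" using p by (simp add: D_def)
    obtain V where V: "\<And>i. i < 2 \<Longrightarrow> openin cantor_seq_space (V i)" "p \<in> Pi\<^sub>E {..<2} V"
      "Pi\<^sub>E {..<2} V \<subseteq> T"
      using T unfolding power_topology_def openin_product_topology_alt by (metis lessThan_iff)
    obtain n where n: "cyl (p 0) n \<subseteq> V 0"
      using V(1)[of 0] PiE_mem[OF V(2), of 0] unfolding openin_cantor_seq_space by auto
    \<comment> \<open>Bit \<open>n\<close> of row 0 lies just outside the window of size
      \<open>n\<close>, so flipping it stays inside \<open>V 0\<close> and breaks the equality of
      the two zeroth rows.\<close>
    define q where "q = p(0 := flip (\<lambda>i l. i = 0 \<and> l = n) (p 0))"
    have "q 0 \<in> V 0" using n by (auto simp: q_def flip_def cyl_def)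
    then have "q \<in> Pi\<^sub>E {..<2} V" using V(2) by (auto simp: PiE_iff q_def extensional_def)
    moreover have "q 0 0 n \<noteq> q 1 0 n" using eq by (simp add: q_def flip_def)
    then have "q \<in> D" using p by (auto simp: D_def power_topology_def PiE_iff q_def extensional_def)
    ultimately show ?thesis using V(3) by blast
  qed (use T in blast)
  then show "p \<in> power_topology 2 cantor_seq_space closure_of D"
    using p unfolding in_closure_of by blast
qed

lemma comeager_in_D: "comeager_in (power_topology 2 cantor_seq_space) D"
  unfolding comeager_in_def
proof
  show "D \<subseteq> topspace (power_topology 2 cantor_seq_space)" unfolding D_def by blast
  show "meager_in (power_topology 2 cantor_seq_space) (topspace (power_topology 2 cantor_seq_space) - D)"
    using openin_D closure_of_D
    by (intro meager_in_closedin) (simp_all add: closedin_diff interior_of_complement)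
qed

theorem theorem18p2:
  shows "openin (power_topology 2 cantor_seq_space) D
    \<and> power_topology 2 cantor_seq_space closure_of D = topspace (power_topology 2 cantor_seq_space)
    \<and> (\<forall>B. Sigma11_in cantor_seq_space B \<and>
           Delta11_bireducible (subtopology cantor_seq_space B) (Restr E3 B) cantor_seq_space E3
           \<longrightarrow> \<not> inequivalent_tuples E3 2 B \<subseteq> D)
    \<and> \<not> mycielski_property 2 cantor_seq_space E3"
proof (intro conjI allI impI openin_D closure_of_D)
  fix B assume "Sigma11_in cantor_seq_space B \<and>
      Delta11_bireducible (subtopology cantor_seq_space B) (Restr E3 B) cantor_seq_space E3"
  then show "\<not> inequivalent_tuples E3 2 B \<subseteq> D"
    using inequivalent_tuples_not_subset_D unfolding Delta11_bireducible_def by blast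
next
  show "\<not> mycielski_property 2 cantor_seq_space E3"
  proof
    assume "mycielski_property 2 cantor_seq_space E3"
    then obtain A where "Delta11_bireducible cantor_seq_space E3 (subtopology cantor_seq_space A) (Restr E3 A)"
      "inequivalent_tuples E3 2 A \<subseteq> D"
      using comeager_in_D unfolding mycielski_property_def by blast
    then show False
      using inequivalent_tuples_not_subset_D unfolding Delta11_bireducible_def by blast
  qed
qed

end
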